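(* Let $F=(F_1,\ldots,F_n)$ be a tuple of real polynomials in $x\in\mathbb{R}^n$ and let $X=\{x\in\mathbb{R}^n: g_i(x)\ge 0\ (i\in\mathcal{I}),\ g_i(x)=0\ (i\in\mathcal{E})\}$ be a convex set, where $g=(g_1,\ldots,g_m)$ is a nonsingular tuple of real polynomials. Let $\Theta\in\mathbb{R}^{(n+1)\times(n+1)}$ be a generic positive definite matrix, and consider the optimization problem $$\min_{x\in\mathbb{R}^n}\ [x]_1^T\Theta[x]_1\quad\text{subject to}\quad x\in\mathcal{K}.\qquad (P)$$ If (P) is infeasible, then the variational inequality problem $\mathrm{VI}(X,F)$ does not have any solution. Otherwise, the set of minimizers of (P) is nonempty, and every minimizer of (P) solves $\mathrm{VI}(X,F)$.
   Context: Throughout, $X\subseteq\mathbb{R}^n$ is nonempty and closed; $\mathcal{E}$ and $\mathcal{I}$ are disjoint index sets with $\mathcal{E}\cup\mathcal{I}=[m]=\{1,\ldots,m\}$. $\mathrm{VI}(X,F)$ is the problem of finding $x\in X$ such that $(y-x)^TF(x)\ge 0$ for all $y\in X$; its solution set is $\mathrm{SOL}(X,F)$. $[x]_1:=(1,x_1,\ldots,x_n)^T$. A property holds generically if it holds for all points of the space of input data except a set of Lebesgue measure zero. Let $G(x)$ be the $(n+m)\times m$ polynomial matrix whose $i$th column is $\nabla g_i(x)$ stacked on top of $g_i(x)e_i$ ($e_i$ the $i$th standard basis vector of $\mathbb{R}^m$). The tuple $g$ is called nonsingular if $G(x)$ has full column rank for every $x\in\mathbb{C}^n$. Equivalently (known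 result), there is a matrix $L(x)$ of real polynomials with $L(x)G(x)=I_m$. Fix such an $L(x)$, and let $\hat F(x):=(F(x)^T,0,\ldots,0)^T\in\mathbb{R}[x]^{n+m}$, $\lambda(x)=(\lambda_1(x),\ldots,\lambda_m(x)):=L(x)\hat F(x)$ (polynomial Lagrange multiplier expression). Then $\mathcal{K}$ is the set of $x\in\mathbb{R}^n$ satisfying $$F(x)=\sum_{i=1}^m\lambda_i(x)\nabla g_i(x),\quad g_i(x)=0\ (i\in\mathcal{E}),\quad \lambda_i(x)\ge0,\ g_i(x)\ge0,\ \lambda_i(x)g_i(x)=0\ (i\in\mathcal{I}).$$ ($\mathcal{K}$ coincides with the set of KKT points of $\mathrm{VI}(X,F)$.) *)

theory Defs
  imports "HOL-Analysis.Analysis" "HOL-Library.Poly_Mapping"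
begin

section \<open>Real polynomials in the variables \<open>x\<^sub>k\<close>, \<open>k :: 'n\<close>\<close>

text \<open>A monomial is its exponent vector, a polynomial its coefficient function. The convolution
  product of \<open>Poly_Mapping\<close> makes this a commutative ring, so \<open>**\<close> and \<open>*v\<close> below are products of
  genuine polynomial matrices.\<close>

type_synonym 'n rpoly = "('n \<Rightarrow>\<^sub>0 nat) \<Rightarrow>\<^sub>0 real"

definition peval :: "'n::finite rpoly \<Rightarrow> 'a::real_field ^ 'n \<Rightarrow> 'a" where
  "peval p x = (\<Sum>\<alpha>\<in>Poly_Mapping.keys p.
     of_real (Poly_Mapping.lookup p \<alpha>) * (\<Prod>k\<in>UNIV. (x $ k) ^ Poly_Mapping.lookup \<alpha> k))"

text \<open>The truncated subtraction of exponents is harmless: if \<open>x\<^sub>k\<close> does not occur in a monomial,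
  the new coefficient is \<open>0\<close>.\<close>

definition pdiff :: "'n::finite \<Rightarrow> 'n rpoly \<Rightarrow> 'n rpoly" where
  "pdiff k p = (\<Sum>\<alpha>\<in>Poly_Mapping.keys p.
     Poly_Mapping.single (\<alpha> - Poly_Mapping.single k 1)
       (of_nat (Poly_Mapping.lookup \<alpha> k) * Poly_Mapping.lookup p \<alpha>))"

definition peval_vec :: "'n::finite rpoly ^ 'd \<Rightarrow> 'a::real_field ^ 'n \<Rightarrow> 'a ^ 'd" where
  "peval_vec p x = (\<chi> i. peval (p $ i) x)"

definition peval_mat :: "'n::finite rpoly ^ 'c ^ 'r \<Rightarrow> 'a::real_field ^ 'n \<Rightarrow> 'a ^ 'c ^ 'r" where
  "peval_mat A x = (\<chi> i j. peval (A $ i $ j) x)"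

definition pgrad :: "'n::finite rpoly \<Rightarrow> 'n rpoly ^ 'n" where
  "pgrad p = (\<chi> k. pdiff k p)"

lemma peval_superset:
  assumes "finite S" "Poly_Mapping.keys p \<subseteq> S"
  shows "peval p x = (\<Sum>\<alpha>\<in>S. of_real (Poly_Mapping.lookup p \<alpha>) * (\<Prod>k\<in>UNIV. (x $ k) ^ Poly_Mapping.lookup \<alpha> k))"
  unfolding peval_def using assms by (intro sum.mono_neutral_left) (auto simp: in_keys_iff)

lemma peval_0 [simp]: "peval 0 x = 0"
  by (simp add: peval_def)

lemma peval_add: "peval (p + q) x = peval p x + peval q x"
proof -
  let ?S = "Poly_Mapping.keys p \<union> Poly_Mapping.keys q"
  have "Poly_Mapping.keys (p + q) \<subseteq> ?S" by (rule Poly_Mapping.keys_add)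
  then show ?thesis
    by (simp add: peval_superset[of ?S] lookup_add distrib_right sum.distrib)
qed

lemma peval_sum: "peval (\<Sum>i\<in>A. f i) x = (\<Sum>i\<in>A. peval (f i) x)"
  by (induction A rule: infinite_finite_induct) (auto simp: peval_add)

lemma peval_single:
  "peval (Poly_Mapping.single \<alpha> c) x = of_real c * (\<Prod>k\<in>UNIV. (x $ k) ^ Poly_Mapping.lookup \<alpha> k)"
  by (simp add: peval_superset[of "{\<alpha>}"])

text \<open>The formal partial derivatives are the analytic ones.\<close>

lemma has_derivative_peval:
  fixes x :: "real ^ 'n::finite"
  shows "((\<lambda>x. peval p x) has_derivative (\<lambda>h. peval_vec (pgrad p) x \<bullet> h)) (at x)"
proof -
  have mono: "(of_nat (Poly_Mapping.lookup \<alpha> i) * (x $ i) ^ (Poly_Mapping.lookup \<alpha> i - 1)) *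
        (\<Prod>k\<in>UNIV - {i}. (x $ k) ^ Poly_Mapping.lookup \<alpha> k)
      = of_nat (Poly_Mapping.lookup \<alpha> i) *
        (\<Prod>k\<in>UNIV. (x $ k) ^ Poly_Mapping.lookup (\<alpha> - Poly_Mapping.single i 1) k)" for \<alpha> i
  proof -
    have "(\<Prod>k\<in>UNIV. (x $ k) ^ Poly_Mapping.lookup (\<alpha> - Poly_Mapping.single i 1) k)
        = (x $ i) ^ (Poly_Mapping.lookup \<alpha> i - 1) *
          (\<Prod>k\<in>UNIV - {i}. (x $ k) ^ Poly_Mapping.lookup (\<alpha> - Poly_Mapping.single i 1) k)"
      by (subst prod.remove[of UNIV i]) (auto simp: lookup_minus)
    also have "(\<Prod>k\<in>UNIV - {i}. (x $ k) ^ Poly_Mapping.lookup (\<alpha> - Poly_Mapping.single i 1) k)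
        = (\<Prod>k\<in>UNIV - {i}. (x $ k) ^ Poly_Mapping.lookup \<alpha> k)"
      by (intro prod.cong) (auto simp: lookup_minus lookup_single)
    finally show ?thesis by simp
  qed
  have "((\<lambda>x. peval p x) has_derivative
     (\<lambda>h. \<Sum>\<alpha>\<in>Poly_Mapping.keys p. Poly_Mapping.lookup p \<alpha> * (\<Sum>i\<in>UNIV.
        (of_nat (Poly_Mapping.lookup \<alpha> i) * h $ i * (x $ i) ^ (Poly_Mapping.lookup \<alpha> i - 1)) *
        (\<Prod>k\<in>UNIV - {i}. (x $ k) ^ Poly_Mapping.lookup \<alpha> k)))) (at x)"
    unfolding peval_def
    by (rule derivative_eq_intros bounded_linear_imp_has_derivative bounded_linear_vec_nth refl)+
       (simp add: mult_ac)
  also have "(\<lambda>h. \<Sum>\<alpha>\<in>Poly_Mapping.keys p. Poly_Mapping.lookup p \<alpha> * (\<Sum>i\<in>UNIV.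
        (of_nat (Poly_Mapping.lookup \<alpha> i) * h $ i * (x $ i) ^ (Poly_Mapping.lookup \<alpha> i - 1)) *
        (\<Prod>k\<in>UNIV - {i}. (x $ k) ^ Poly_Mapping.lookup \<alpha> k)))
     = (\<lambda>h. \<Sum>\<alpha>\<in>Poly_Mapping.keys p. \<Sum>i\<in>UNIV. Poly_Mapping.lookup p \<alpha> * h $ i *
        ((of_nat (Poly_Mapping.lookup \<alpha> i) * (x $ i) ^ (Poly_Mapping.lookup \<alpha> i - 1)) *
        (\<Prod>k\<in>UNIV - {i}. (x $ k) ^ Poly_Mapping.lookup \<alpha> k)))"
    by (simp add: sum_distrib_left mult_ac)
  also have "\<dots> = (\<lambda>h. peval_vec (pgrad p) x \<bullet> h)"
    unfolding mono
    by (subst sum.swap, rule ext)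
       (simp add: inner_vec_def peval_vec_def pgrad_def pdiff_def peval_sum peval_single
          sum_distrib_left sum_distrib_right mult_ac)
  finally show ?thesis .
qed

section \<open>Variational inequalities\<close>

definition SOL :: "(real ^ 'n) set \<Rightarrow> (real ^ 'n \<Rightarrow> real ^ 'n) \<Rightarrow> (real ^ 'n) set" where
  "SOL X F = {x \<in> X. \<forall>y\<in>X. (y - x) \<bullet> F x \<ge> 0}"

definition feasible_set :: "'n::finite rpoly ^ 'm::finite \<Rightarrow> 'm set \<Rightarrow> 'm set \<Rightarrow> (real ^ 'n) set" where
  "feasible_set g \<E> \<I> = {x. (\<forall>i\<in>\<I>. peval (g $ i) x \<ge> 0) \<and> (\<forall>i\<in>\<E>. peval (g $ i) x = 0)}"

text \<open>Rows are indexed by the disjoint sum \<open>'n + 'm\<close>: the gradient part by \<open>Inl\<close>, the part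
  \<open>g\<^sub>i e\<^sub>i\<close> by \<open>Inr\<close>.\<close>

definition G_mat :: "'n::finite rpoly ^ 'm::finite \<Rightarrow> 'n rpoly ^ 'm ^ ('n + 'm)" where
  "G_mat g = (\<chi> r i. case r of Inl k \<Rightarrow> pgrad (g $ i) $ k
                             | Inr j \<Rightarrow> (if j = i then g $ i else 0))"

definition nonsingular_tuple :: "'n::finite rpoly ^ 'm::finite \<Rightarrow> bool" where
  "nonsingular_tuple g \<longleftrightarrow> (\<forall>x :: complex ^ 'n. rank (peval_mat (G_mat g) x) = CARD('m))"

definition F_hat :: "'n::finite rpoly ^ 'n \<Rightarrow> 'n rpoly ^ ('n + 'm::finite)" where
  "F_hat F = (\<chi> r. case r of Inl k \<Rightarrow> F $ k | Inr j \<Rightarrow> 0)"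

definition lme :: "'n::finite rpoly ^ ('n + 'm::finite) ^ 'm \<Rightarrow> 'n rpoly ^ 'n \<Rightarrow> 'n rpoly ^ 'm" where
  "lme L F = L *v F_hat F"

definition KKT_set :: "'n::finite rpoly ^ 'n \<Rightarrow> 'n rpoly ^ 'm::finite \<Rightarrow> 'm set \<Rightarrow> 'm set
    \<Rightarrow> 'n rpoly ^ ('n + 'm) ^ 'm \<Rightarrow> (real ^ 'n) set" where
  "KKT_set F g \<E> \<I> L = {x.
     peval_vec F x = (\<Sum>i\<in>UNIV. peval (lme L F $ i) x *\<^sub>R peval_vec (pgrad (g $ i)) x) \<and>
     (\<forall>i\<in>\<E>. peval (g $ i) x = 0) \<and>
     (\<forall>i\<in>\<I>. peval (lme L F $ i) x \<ge> 0 \<and> peval (g $ i) x \<ge> 0 \<and>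
            peval (lme L F $ i) x * peval (g $ i) x = 0)}"

section \<open>Generic positive definite matrices and the objective\<close>

text \<open>\<open>[x]\<^sub>1 = (1, x\<^sub>1, \<dots>, x\<^sub>n)\<close>; the index type \<open>'n option\<close> has \<open>n + 1\<close> elements.\<close>

definition homog :: "real ^ 'n \<Rightarrow> real ^ ('n option)" where
  "homog x = (\<chi> i. case i of None \<Rightarrow> 1 | Some k \<Rightarrow> x $ k)"

definition posdef :: "real ^ 'k ^ 'k \<Rightarrow> bool" where
  "posdef A \<longleftrightarrow> transpose A = A \<and> (\<forall>v. v \<noteq> 0 \<longrightarrow> v \<bullet> (A *v v) > 0)"

text \<open>Lebesgue measure on the space of symmetric matrices, which is itself a null set among all
  square matrices. The free entries are indexed by the unordered pairs \<open>{i, j}\<close> (including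
  \<open>i = j\<close>), that is, by the positions in the upper triangle; the measure is transported to the
  symmetric matrices by the coordinate bijection.\<close>

definition sym_of_entries :: "('k set \<Rightarrow> real) \<Rightarrow> real ^ 'k ^ 'k" where
  "sym_of_entries t = (\<chi> i j. t {i, j})"

definition sym_lborel :: "(real ^ 'k ^ 'k) measure" where
  "sym_lborel = distr (\<Pi>\<^sub>M P\<in>{{i, j} | i j :: 'k. True}. lborel) borel sym_of_entries"

lemma measurable_sym_of_entries:
  "sym_of_entries \<in> (\<Pi>\<^sub>M P\<in>{{i, j} | i j :: 'k. True}. lborel) \<rightarrow>\<^sub>M
     (borel :: (real ^ 'k ^ 'k) measure)"
proof (rule borel_measurable_euclidean_space[THEN iffD2], rule ballI)
  fix b :: "real ^ 'k ^ 'k" assume "b \<in> Basis"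
  then obtain i j where b: "b = axis i (axis j 1)" by (auto simp: Basis_vec_def)
  have "(\<lambda>t. t {i, j}) \<in> (\<Pi>\<^sub>M P\<in>{{i, j} | i j :: 'k. True}. lborel) \<rightarrow>\<^sub>M (borel :: real measure)"
    by (subst measurable_cong_sets[OF refl sets_lborel[symmetric]])
       (rule measurable_component_singleton, blast)
  then show "(\<lambda>t. sym_of_entries t \<bullet> b) \<in>
      (\<Pi>\<^sub>M P\<in>{{i, j} | i j :: 'k. True}. lborel) \<rightarrow>\<^sub>M (borel :: real measure)"
    by (simp add: b inner_axis sym_of_entries_def)
qed

end

theory Submission
  imports Defs
begin

text \<open>The set \<open>K\<close> is equal to the solution set of the variational inequality, so the claim reduces
  to the existence of a minimizer. This needs that \<open>K\<close> is closed (it is cut out by polynomial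
  equations and inequalities) and that the objective is coercive, as it is for every positive
  definite \<open>\<Theta>\<close>.

  That a KKT point solves the variational inequality follows from the convexity of the set
  \<open>X\<close>. The segment from a KKT point \<open>x\<close> to
  \<open>y \<in> X\<close> stays in \<open>X\<close>, so along it an equality constraint has derivative \<open>0\<close> at \<open>x\<close> and an active
  inequality constraint a nonnegative one, and \<open>(y - x) \<bullet> F x\<close> is the sum of these
  derivatives with the multipliers as weights, which vanish on the inactive constraints (\<open>KKT_set_subset_SOL\<close>).

  Conversely, a solution \<open>x\<close> minimizes the linear form \<open>y \<mapsto> y \<bullet> F x\<close> over \<open>X\<close>. Quadratic
  penalties give points \<open>y\<^sub>k\<close> tending to \<open>x\<close> and multipliers
  \<open>\<mu>\<^sub>k\<close> that satisfy the KKT system in the limit (\<open>approximate_KKT_sequence\<close>). The multipliers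
  could diverge in general, but the left inverse \<open>L\<close> of \<open>G\<close> recovers them at every point, continuously,
  from the two quantities whose limits are known:
  \<open>\<mu>\<^sub>k = L y\<^sub>k (\<Sum>\<^sub>i \<mu>\<^sub>k\<^sub>i \<nabla>g\<^sub>i y\<^sub>k, (\<mu>\<^sub>k\<^sub>i g\<^sub>i y\<^sub>k)\<^sub>i) \<longlonglongrightarrow> L x (F x, 0) = \<lambda> x\<close>.
  Passing to the limit shows that \<open>\<lambda> x\<close> satisfies the KKT system at \<open>x\<close>
  (\<open>SOL_subset_KKT_set\<close>).\<close>

section \<open>Evaluation of polynomials is a ring homomorphism\<close>

lemma poly_mapping_eq_sum_single:
  "p = (\<Sum>\<alpha>\<in>Poly_Mapping.keys p. Poly_Mapping.single \<alpha> (Poly_Mapping.lookup p \<alpha>))"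
  by (rule poly_mapping_eqI)
     (auto simp: lookup_sum lookup_single when_def in_keys_iff)

lemma peval_mult: "peval (p * q) x = peval p x * peval q x"
proof -
  let ?s = "\<lambda>p \<alpha>. Poly_Mapping.single \<alpha> (Poly_Mapping.lookup p \<alpha>)"
  have "p * q = (\<Sum>\<alpha>\<in>Poly_Mapping.keys p. \<Sum>\<beta>\<in>Poly_Mapping.keys q. ?s p \<alpha> * ?s q \<beta>)"
    by (subst poly_mapping_eq_sum_single[of p], subst poly_mapping_eq_sum_single[of q])
       (rule sum_product)
  also have "peval \<dots> x = peval p x * peval q x"
    by (simp add: peval_sum mult_single peval_single lookup_add power_add prod.distrib
          peval_def[of p] peval_def[of q] sum_product mult_ac)
  finally show ?thesis .
qed

lemma peval_1 [simp]: "peval 1 x = 1"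
  by (simp add: peval_single flip: single_one)

lemma continuous_on_peval: "continuous_on S (peval p :: real ^ 'n::finite \<Rightarrow> real)"
  by (rule has_derivative_continuous_on) (rule has_derivative_at_withinI[OF has_derivative_peval])

lemma tendsto_peval:
  fixes x :: "real ^ 'n::finite"
  assumes "(y \<longlongrightarrow> x) A"
  shows "((\<lambda>k. peval p (y k)) \<longlongrightarrow> peval p x) A"
  using continuous_on_peval[of UNIV p] assms
  by (auto simp: continuous_on_eq_continuous_at isCont_tendsto_compose)

lemma tendsto_peval_vec:
  fixes x :: "real ^ 'n::finite"
  assumes "(y \<longlongrightarrow> x) A"
  shows "((\<lambda>k. peval_vec p (y k)) \<longlongrightarrow> peval_vec p x) A"
  unfolding peval_vec_def by (intro vec_tendstoI) (simp add: tendsto_peval[OF assms])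

section \<open>Approximate multipliers from a quadratic penalty\<close>

lemma has_real_derivative_square_min_0:
  "((\<lambda>t. (min t 0)\<^sup>2) has_real_derivative 2 * min t 0) (at (t::real))"
proof (cases t "0::real" rule: linorder_cases)
  case less
  have "((\<lambda>t. t\<^sup>2) has_real_derivative 2 * min t 0) (at t)"
    using less by (auto intro!: derivative_eq_intros)
  then show ?thesis
    by (rule has_field_derivative_transform_within_open[of _ _ _ "{..<0}"]) (use less in auto)
next
  case greater
  have "((\<lambda>t. 0) has_real_derivative 2 * min t 0) (at t)"
    using greater by auto
  then show ?thesis
    by (rule has_field_derivative_transform_within_open[of _ _ _ "{0<..}"]) (use greater in auto)
next
  case equal
  have "((\<lambda>h::real. (min h 0)\<^sup>2 / h) \<longlongrightarrow> 0) (at 0)"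
  proof (rule Lim_null_comparison)
    show "\<forall>\<^sub>F h::real in at 0. norm ((min h 0)\<^sup>2 / h) \<le> \<bar>h\<bar>"
      by (auto simp: min_def power2_eq_square)
    show "((\<lambda>h::real. \<bar>h\<bar>) \<longlongrightarrow> 0) (at 0)"
      by (rule tendsto_eq_intros refl | simp)+
  qed
  with equal show ?thesis
    by (simp add: has_field_derivative_iff)
qed

text \<open>The sequential form of the first-order conditions at a minimizer. Minimizing \<open>(y - x) \<bullet> c + (norm (y - x))\<^sup>2 + k * P y\<close> over a ball around \<open>x\<close>, where
  \<open>P\<close> is the sum of the squared constraint violations, gives points that become feasible in the limit;
  the quadratic term then forces them to tend to \<open>x\<close>. They are eventually interior to the ball, where
  the gradient of the penalized function vanishes, and the coefficients of the constraint gradients in this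
  equation are the multipliers. The products \<open>\<mu> k i * g i (y k)\<close> tend to \<open>0\<close> because each
  is, up to the factor \<open>- 2\<close>, a term of the penalty \<open>k * P\<close>, which the value at the minimum
  bounds by \<open>- ((y - x) \<bullet> c)\<close>.\<close>

theorem approximate_KKT_sequence:
  fixes g :: "'m::finite \<Rightarrow> 'a::euclidean_space \<Rightarrow> real" and dg :: "'m \<Rightarrow> 'a \<Rightarrow> 'a"
  assumes deriv: "\<And>i x. (g i has_derivative (\<lambda>h. dg i x \<bullet> h)) (at x)"
    and disj: "\<E> \<inter> \<I> = {}" and cover: "\<E> \<union> \<I> = UNIV"
    and feas: "\<forall>i\<in>\<E>. g i x = 0" "\<forall>i\<in>\<I>. g i x \<ge> 0"
    and opt: "\<And>y. \<lbrakk>\<forall>i\<in>\<E>. g i y = 0; \<forall>i\<in>\<I>. g i y \<ge> 0\<rbrakk> \<Longrightarrow> (y - x) \<bullet> c \<ge> 0"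
  obtains y :: "nat \<Rightarrow> 'a" and \<mu> :: "nat \<Rightarrow> 'm \<Rightarrow> real" where
    "y \<longlonglongrightarrow> x"
    "(\<lambda>k. \<Sum>i\<in>UNIV. \<mu> k i *\<^sub>R dg i (y k)) \<longlonglongrightarrow> c"
    "\<And>i. (\<lambda>k. \<mu> k i * g i (y k)) \<longlonglongrightarrow> 0"
    "\<And>k i. i \<in> \<I> \<Longrightarrow> \<mu> k i \<ge> 0"
proof -
  define v where "v i t = (if i \<in> \<I> then min t 0 else t)" for i and t :: real
  define P where "P y = (\<Sum>i\<in>UNIV. (v i (g i y))\<^sup>2)" for y
  define \<phi> where "\<phi> k y = (y - x) \<bullet> c + (norm (y - x))\<^sup>2 + real k * P y" for k y

  have v_deriv: "((\<lambda>t. (v i t)\<^sup>2) has_real_derivative 2 * v i t) (at t)" for i t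
    using has_real_derivative_square_min_0[of t]
    by (cases "i \<in> \<I>") (auto simp: v_def intro!: derivative_eq_intros)
  \<comment> \<open>This identity turns the complementarity products into terms of the penalty.\<close>
  have v_sq: "v i t * t = (v i t)\<^sup>2" for i t
    by (auto simp: v_def min_def power2_eq_square)
  have P_deriv: "(P has_derivative (\<lambda>h. \<Sum>i\<in>UNIV. 2 * v i (g i y) * (dg i y \<bullet> h))) (at y)" for y
    unfolding P_def
    by (intro has_derivative_sum has_derivative_compose[OF deriv, of "\<lambda>t. (v _ t)\<^sup>2", simplified])
       (use v_deriv in \<open>simp add: has_field_derivative_def\<close>)
  have P_nonneg: "P y \<ge> 0" for y
    by (simp add: P_def sum_nonneg)
  have P_zero: "P y = 0 \<longleftrightarrow> (\<forall>i\<in>\<E>. g i y = 0) \<and> (\<forall>i\<in>\<I>. g i y \<ge> 0)" for y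
  proof -
    have "P y = 0 \<longleftrightarrow> (\<forall>i. v i (g i y) = 0)"
      by (simp add: P_def sum_nonneg_eq_0_iff)
    also have "\<dots> \<longleftrightarrow> (\<forall>i\<in>\<E>. v i (g i y) = 0) \<and> (\<forall>i\<in>\<I>. v i (g i y) = 0)"
      using cover by blast
    also have "\<dots> \<longleftrightarrow> (\<forall>i\<in>\<E>. g i y = 0) \<and> (\<forall>i\<in>\<I>. g i y \<ge> 0)"
      using disj by (auto simp: v_def min_def split: if_splits)
    finally show ?thesis .
  qed
  have P_x: "P x = 0"
    using P_zero feas by blast
  have P_cont: "continuous_on S P" for S
    by (rule has_derivative_continuous_on, rule has_derivative_at_withinI, rule P_deriv)
  have \<phi>_deriv: "(\<phi> k has_derivative (\<lambda>h. (c + 2 *\<^sub>R (y - x) +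
      (\<Sum>i\<in>UNIV. (2 * real k * v i (g i y)) *\<^sub>R dg i y)) \<bullet> h)) (at y)" for k y
    unfolding \<phi>_def power2_norm_eq_inner
    by (auto intro!: derivative_eq_intros P_deriv
        simp: inner_add_left inner_diff_left inner_diff_right inner_sum_left inner_sum_right sum_distrib_left
          inner_commute algebra_simps)

  have "\<exists>z\<in>cball x 1. \<forall>y\<in>cball x 1. \<phi> k z \<le> \<phi> k y" for k
    unfolding \<phi>_def
    by (intro continuous_attains_inf continuous_intros P_cont) auto
  then obtain z where z: "z k \<in> cball x 1" "y \<in> cball x 1 \<Longrightarrow> \<phi> k (z k) \<le> \<phi> k y" for k y
    by metis
  \<comment> \<open>Compare with the value \<open>0\<close> at \<open>x\<close>: this controls both the violation and the distance to \<open>x\<close>.\<close>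
  have bound: "(z k - x) \<bullet> c + (norm (z k - x))\<^sup>2 + real k * P (z k) \<le> 0" for k
    using z(2)[of x k] by (simp add: \<phi>_def P_x)

  obtain x' r where r: "strict_mono (r :: nat \<Rightarrow> nat)" "(z \<circ> r) \<longlonglongrightarrow> x'"
    using seq_compactE[of "cball x 1" z] z(1) by (metis compact_cball compact_imp_seq_compact)
  define y where "y k = z (r k)" for k
  have y_lim': "y \<longlonglongrightarrow> x'"
    using r(2) by (simp add: y_def[abs_def] comp_def)
  have r_lim: "filterlim (\<lambda>k. real (r k)) at_top sequentially"
    using r(1) filterlim_compose filterlim_real_sequentially filterlim_subseq by blast
  have dist_y: "norm (y k - x) \<le> 1" for k
    using z(1)[of "r k"] by (simp add: y_def dist_norm norm_minus_commute)
  have P_bound: "real (r k) * P (y k) \<le> norm c" for k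
  proof -
    have "- ((y k - x) \<bullet> c) \<le> norm (y k - x) * norm c"
      using Cauchy_Schwarz_ineq2[of "y k - x" c] by linarith
    also have "\<dots> \<le> norm c"
      using mult_right_mono[OF dist_y norm_ge_zero, of k c] by simp
    finally show ?thesis
      using bound[of "r k"] zero_le_power2[of "norm (y k - x)"] unfolding y_def by linarith
  qed
  have "(\<lambda>k. P (y k)) \<longlonglongrightarrow> 0"
  proof (rule Lim_null_comparison)
    show "\<forall>\<^sub>F k in sequentially. norm (P (y k)) \<le> norm c / real (r k)"
      using r_lim[unfolded filterlim_at_top_dense, rule_format, of 0]
      by eventually_elim (use P_bound P_nonneg in \<open>auto simp: field_simps\<close>)
    show "(\<lambda>k. norm c / real (r k)) \<longlonglongrightarrow> 0"
      by (intro tendsto_divide_0[OF tendsto_const] filterlim_at_top_imp_at_infinity r_lim)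
  qed
  moreover have "(\<lambda>k. P (y k)) \<longlonglongrightarrow> P x'"
    using P_cont[of UNIV] y_lim' by (auto simp: continuous_on_eq_continuous_at isCont_tendsto_compose)
  ultimately have "P x' = 0"
    by (rule LIMSEQ_unique[symmetric])
  then have "(x' - x) \<bullet> c \<ge> 0"
    using P_zero opt by blast
  moreover have "(x' - x) \<bullet> c + (norm (x' - x))\<^sup>2 \<le> 0"
  proof (rule LIMSEQ_le_const2)
    show "(\<lambda>k. (y k - x) \<bullet> c + (norm (y k - x))\<^sup>2) \<longlonglongrightarrow> (x' - x) \<bullet> c + (norm (x' - x))\<^sup>2"
      by (intro tendsto_intros y_lim')
    have "(y k - x) \<bullet> c + (norm (y k - x))\<^sup>2 \<le> 0" for k
      using bound[of "r k"] mult_nonneg_nonneg[OF of_nat_0_le_iff P_nonneg, of "r k" "y k"]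
      unfolding y_def by linarith
    then show "\<exists>N. \<forall>k\<ge>N. (y k - x) \<bullet> c + (norm (y k - x))\<^sup>2 \<le> 0"
      by blast
  qed
  \<comment> \<open>The limit point is feasible, so the linear term cannot compensate the quadratic one.\<close>
  ultimately have "(norm (x' - x))\<^sup>2 \<le> 0"
    by linarith
  then have y_lim: "y \<longlonglongrightarrow> x"
    using y_lim' by simp

  have kP_lim: "(\<lambda>k. real (r k) * P (y k)) \<longlonglongrightarrow> 0"
  proof (rule Lim_null_comparison)
    show "\<forall>\<^sub>F k in sequentially. norm (real (r k) * P (y k)) \<le> - ((y k - x) \<bullet> c)"
    proof (rule always_eventually, rule allI)
      fix k
      show "norm (real (r k) * P (y k)) \<le> - ((y k - x) \<bullet> c)"
        using bound[of "r k"] zero_le_power2[of "norm (y k - x)"]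
          mult_nonneg_nonneg[OF of_nat_0_le_iff P_nonneg, of "r k" "y k"]
        unfolding y_def real_norm_def by linarith
    qed
    have "(\<lambda>k. - ((y k - x) \<bullet> c)) \<longlonglongrightarrow> - ((x - x) \<bullet> c)"
      by (intro tendsto_intros y_lim)
    then show "(\<lambda>k. - ((y k - x) \<bullet> c)) \<longlonglongrightarrow> 0"
      by simp
  qed

  \<comment> \<open>The sign moves the constraint gradients to the other side of the stationarity equation.\<close>
  define \<mu> where "\<mu> k i = - 2 * real (r k) * v i (g i (y k))" for k i
  have stationary: "(\<Sum>i\<in>UNIV. \<mu> k i *\<^sub>R dg i (y k)) = c + 2 *\<^sub>R (y k - x)" if "dist (y k) x < 1" for k
  proof -
    let ?w = "c + 2 *\<^sub>R (y k - x) + (\<Sum>i\<in>UNIV. (2 * real (r k) * v i (g i (y k))) *\<^sub>R dg i (y k))"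
    have "(\<lambda>h. ?w \<bullet> h) = (\<lambda>h. 0)"
    proof (rule differential_zero_maxmin)
      show "y k \<in> ball x 1" "open (ball x (1::real))"
        using that by (simp_all add: dist_commute)
      show "(\<phi> (r k) has_derivative (\<lambda>h. ?w \<bullet> h)) (at (y k))"
        by (rule \<phi>_deriv)
      show "(\<forall>u\<in>ball x 1. \<phi> (r k) u \<le> \<phi> (r k) (y k)) \<or> (\<forall>u\<in>ball x 1. \<phi> (r k) (y k) \<le> \<phi> (r k) u)"
        using z(2) by (simp add: y_def)
    qed
    then have "?w \<bullet> ?w = 0"
      by metis
    then have "?w = 0"
      by simp
    then show ?thesis
      by (simp add: \<mu>_def sum_negf add_eq_0_iff)
  qed

  show thesis
  proof (rule that[of y \<mu>])
    show "y \<longlonglongrightarrow> x"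
      by (fact y_lim)
    have "(\<lambda>k. c + 2 *\<^sub>R (y k - x)) \<longlonglongrightarrow> c + 2 *\<^sub>R (x - x)"
      by (intro tendsto_intros y_lim)
    then have "(\<lambda>k. c + 2 *\<^sub>R (y k - x)) \<longlonglongrightarrow> c"
      by simp
    moreover have "\<forall>\<^sub>F k in sequentially. c + 2 *\<^sub>R (y k - x) = (\<Sum>i\<in>UNIV. \<mu> k i *\<^sub>R dg i (y k))"
      using tendstoD[OF y_lim zero_less_one] by eventually_elim (simp add: stationary)
    ultimately show "(\<lambda>k. \<Sum>i\<in>UNIV. \<mu> k i *\<^sub>R dg i (y k)) \<longlonglongrightarrow> c"
      by (rule Lim_transform_eventually)
    show "(\<lambda>k. \<mu> k i * g i (y k)) \<longlonglongrightarrow> 0" for i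
    proof (rule Lim_null_comparison)
      show "\<forall>\<^sub>F k in sequentially. norm (\<mu> k i * g i (y k)) \<le> 2 * (real (r k) * P (y k))"
      proof (rule always_eventually, rule allI)
        fix k
        have "norm (\<mu> k i * g i (y k)) = 2 * (real (r k) * (v i (g i (y k)))\<^sup>2)"
          unfolding \<mu>_def by (simp add: mult.assoc v_sq)
        also have "(v i (g i (y k)))\<^sup>2 \<le> P (y k)"
          unfolding P_def by (rule member_le_sum) auto
        finally show "norm (\<mu> k i * g i (y k)) \<le> 2 * (real (r k) * P (y k))"
          by (simp add: mult_left_mono)
      qed
      show "(\<lambda>k. 2 * (real (r k) * P (y k))) \<longlonglongrightarrow> 0"
        using tendsto_mult_left[OF kP_lim, of 2] by simp
    qed
    show "\<mu> k i \<ge> 0" if "i \<in> \<I>" for k i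
      using that by (auto simp: \<mu>_def v_def mult_nonneg_nonpos)
  qed
qed

section \<open>The solutions of the variational inequality are the KKT points\<close>

text \<open>Apply \<open>L ** G = mat 1\<close>, evaluated at \<open>y\<close>, to the vector \<open>\<mu>\<close>. The result
  expresses multipliers through the two quantities that \<open>approximate_KKT_sequence\<close> controls.\<close>

lemma multipliers_from_left_inverse:
  fixes L :: "'n::finite rpoly ^ ('n + 'm::finite) ^ 'm" and y :: "real ^ 'n"
  assumes "L ** G_mat g = mat 1"
  shows "\<mu> i = (\<Sum>l\<in>UNIV. peval (L $ i $ Inl l) y * (\<Sum>j\<in>UNIV. \<mu> j *\<^sub>R peval_vec (pgrad (g $ j)) y) $ l)
             + (\<Sum>j\<in>UNIV. peval (L $ i $ Inr j) y * (\<mu> j * peval (g $ j) y))"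
proof -
  have sum_split: "(\<Sum>r\<in>UNIV. f r) = (\<Sum>l\<in>UNIV. f (Inl l)) + (\<Sum>j\<in>UNIV. f (Inr j))"
    for f :: "'n + 'm \<Rightarrow> real"
    by (simp add: sum.Plus flip: UNIV_Plus_UNIV)
  have row: "(\<Sum>l\<in>UNIV. peval (L $ i $ Inl l) y * peval (pgrad (g $ j) $ l) y)
      + peval (L $ i $ Inr j) y * peval (g $ j) y = (if i = j then 1 else 0)" for j
  proof -
    have "(\<Sum>r\<in>UNIV. peval (L $ i $ r) y * peval (G_mat g $ r $ j) y) = peval ((L ** G_mat g) $ i $ j) y"
      by (simp add: matrix_matrix_mult_def peval_sum peval_mult)
    also have "\<dots> = (if i = j then 1 else 0)"
      by (simp add: assms mat_def)
    finally show ?thesis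
      by (simp add: sum_split G_mat_def if_distrib[of "\<lambda>p. peval p y"]
          if_distrib[of "(*) (peval p y)" for p] cong: if_cong)
  qed
  have "\<mu> i = (\<Sum>j\<in>UNIV. (if i = j then 1 else 0) * \<mu> j)"
    by (simp add: if_distrib[of "\<lambda>a. a * \<mu> j" for j] cong: if_cong)
  also have "\<dots> = (\<Sum>j\<in>UNIV. \<Sum>l\<in>UNIV. peval (L $ i $ Inl l) y * (\<mu> j * peval (pgrad (g $ j) $ l) y))
      + (\<Sum>j\<in>UNIV. peval (L $ i $ Inr j) y * (\<mu> j * peval (g $ j) y))"
    unfolding row[symmetric]
    by (simp add: algebra_simps sum_distrib_left sum_distrib_right sum.distrib)
  also have "(\<Sum>j\<in>UNIV. \<Sum>l\<in>UNIV. peval (L $ i $ Inl l) y * (\<mu> j * peval (pgrad (g $ j) $ l) y))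
      = (\<Sum>l\<in>UNIV. peval (L $ i $ Inl l) y * (\<Sum>j\<in>UNIV. \<mu> j *\<^sub>R peval_vec (pgrad (g $ j)) y) $ l)"
    by (subst sum.swap) (simp add: peval_vec_def sum_distrib_left)
  finally show ?thesis .
qed

lemma peval_lme:
  fixes L :: "'n::finite rpoly ^ ('n + 'm::finite) ^ 'm"
  shows "peval (lme L F $ i) x = (\<Sum>l\<in>UNIV. peval (L $ i $ Inl l) x * peval_vec F x $ l)"
proof -
  have "peval (lme L F $ i) x = (\<Sum>r\<in>UNIV <+> UNIV. peval (L $ i $ r) x * peval ((F_hat F :: _ ^ ('n + 'm)) $ r) x)"
    by (simp add: lme_def matrix_vector_mult_def peval_sum peval_mult)
  also have "\<dots> = (\<Sum>l\<in>UNIV. peval (L $ i $ Inl l) x * peval_vec F x $ l)"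
    by (subst sum.Plus) (simp_all add: F_hat_def peval_vec_def)
  finally show ?thesis .
qed

lemma SOL_subset_KKT_set:
  fixes L :: "'n::finite rpoly ^ ('n + 'm::finite) ^ 'm"
  assumes disj: "\<E> \<inter> \<I> = {}" and cover: "\<E> \<union> \<I> = UNIV"
    and L: "L ** G_mat g = mat 1"
  shows "SOL (feasible_set g \<E> \<I>) (peval_vec F) \<subseteq> KKT_set F g \<E> \<I> L"
proof
  fix x :: "real ^ 'n"
  assume "x \<in> SOL (feasible_set g \<E> \<I>) (peval_vec F)"
  then have feas: "\<forall>i\<in>\<E>. peval (g $ i) x = 0" "\<forall>i\<in>\<I>. peval (g $ i) x \<ge> 0"
    and opt: "\<And>y. \<lbrakk>\<forall>i\<in>\<E>. peval (g $ i) y = 0; \<forall>i\<in>\<I>. peval (g $ i) y \<ge> 0\<rbrakk>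
      \<Longrightarrow> (y - x) \<bullet> peval_vec F x \<ge> 0"
    by (auto simp: SOL_def feasible_set_def)
  obtain y \<mu> where y: "y \<longlonglongrightarrow> x"
    and grad: "(\<lambda>k. \<Sum>i\<in>UNIV. \<mu> k i *\<^sub>R peval_vec (pgrad (g $ i)) (y k)) \<longlonglongrightarrow> peval_vec F x"
    and compl: "\<And>i. (\<lambda>k. \<mu> k i * peval (g $ i) (y k)) \<longlonglongrightarrow> 0"
    and nonneg: "\<And>k i. i \<in> \<I> \<Longrightarrow> \<mu> k i \<ge> 0"
    by (rule approximate_KKT_sequence[of "\<lambda>i. peval (g $ i)" "\<lambda>i. peval_vec (pgrad (g $ i))",
          OF has_derivative_peval disj cover feas opt]) blast+
  \<comment> \<open>Nonsingularity makes the approximate multipliers converge, and \<open>\<lambda> x\<close> is their limit.\<close>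
  have \<mu>_lim: "(\<lambda>k. \<mu> k i) \<longlonglongrightarrow> peval (lme L F $ i) x" for i
  proof -
    have "(\<lambda>k. (\<Sum>l\<in>UNIV. peval (L $ i $ Inl l) (y k) *
            (\<Sum>j\<in>UNIV. \<mu> k j *\<^sub>R peval_vec (pgrad (g $ j)) (y k)) $ l)
          + (\<Sum>j\<in>UNIV. peval (L $ i $ Inr j) (y k) * (\<mu> k j * peval (g $ j) (y k))))
        \<longlonglongrightarrow> (\<Sum>l\<in>UNIV. peval (L $ i $ Inl l) x * peval_vec F x $ l)
          + (\<Sum>j\<in>UNIV. peval (L $ i $ Inr j) x * 0)"
      by (intro tendsto_add tendsto_sum tendsto_mult tendsto_peval[OF y] tendsto_vec_nth grad compl)
    then show ?thesis
      by (simp only: peval_lme multipliers_from_left_inverse[OF L, symmetric]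
            mult_zero_right sum.neutral_const add_0_right)
  qed
  have "(\<lambda>k. \<Sum>i\<in>UNIV. \<mu> k i *\<^sub>R peval_vec (pgrad (g $ i)) (y k))
      \<longlonglongrightarrow> (\<Sum>i\<in>UNIV. peval (lme L F $ i) x *\<^sub>R peval_vec (pgrad (g $ i)) x)"
    by (intro tendsto_sum tendsto_scaleR \<mu>_lim tendsto_peval_vec y)
  then have "peval_vec F x = (\<Sum>i\<in>UNIV. peval (lme L F $ i) x *\<^sub>R peval_vec (pgrad (g $ i)) x)"
    using grad LIMSEQ_unique by blast
  moreover have "peval (lme L F $ i) x \<ge> 0" if "i \<in> \<I>" for i
    using LIMSEQ_le_const[OF \<mu>_lim] nonneg[OF that] by blast
  moreover have "peval (lme L F $ i) x * peval (g $ i) x = 0" for i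
    using tendsto_mult[OF \<mu>_lim tendsto_peval[OF y]] compl LIMSEQ_unique by blast
  ultimately show "x \<in> KKT_set F g \<E> \<I> L"
    using feas by (simp add: KKT_set_def)
qed

lemma convex_first_order:
  fixes f :: "'a::real_inner \<Rightarrow> real"
  assumes S: "convex S" "x \<in> S" "y \<in> S"
    and deriv: "(f has_derivative (\<lambda>h. d \<bullet> h)) (at x)"
    and min: "\<And>z. z \<in> S \<Longrightarrow> f x \<le> f z"
  shows "d \<bullet> (y - x) \<ge> 0"
proof (rule ccontr)
  assume "\<not> d \<bullet> (y - x) \<ge> 0"
  moreover have "((\<lambda>t. f (x + t *\<^sub>R (y - x))) has_real_derivative d \<bullet> (y - x)) (at 0)"
  proof -
    have "((\<lambda>t. x + t *\<^sub>R (y - x)) has_derivative (\<lambda>t. t *\<^sub>R (y - x))) (at 0)"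
      by (auto intro!: derivative_eq_intros)
    from has_derivative_compose[OF this, of f "\<lambda>h. d \<bullet> h"] deriv show ?thesis
      by (simp add: has_field_derivative_def mult_commute_abs)
  qed
  ultimately obtain e where "e > 0" and dec: "\<And>t. 0 < t \<Longrightarrow> t < e \<Longrightarrow> f (x + t *\<^sub>R (y - x)) < f x"
    using DERIV_neg_dec_right[of "\<lambda>t. f (x + t *\<^sub>R (y - x))" "d \<bullet> (y - x)" 0] by auto
  define t where "t = min 1 (e / 2)"
  have t: "0 < t" "t < e" "t \<le> 1"
    using \<open>e > 0\<close> by (auto simp: t_def)
  have "x + t *\<^sub>R (y - x) = (1 - t) *\<^sub>R x + t *\<^sub>R y"
    by (simp add: algebra_simps)
  then have "x + t *\<^sub>R (y - x) \<in> S"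
    using convexD_alt[OF S, of t] t by simp
  from min[OF this] dec[OF t(1,2)] show False
    by simp
qed

text \<open>Each constraint is handled on its own: \<open>x\<close> minimizes an active inequality constraint over the
  feasible set, and it minimizes both \<open>g\<^sub>i\<close> and \<open>- g\<^sub>i\<close> if \<open>g\<^sub>i\<close> is an equality constraint, so
  \<open>convex_first_order\<close> gives the sign of the derivative towards any feasible \<open>y\<close>. The multipliers
  of the remaining constraints vanish.\<close>

lemma KKT_set_subset_SOL:
  assumes cover: "\<E> \<union> \<I> = UNIV" and conv: "convex (feasible_set g \<E> \<I>)"
  shows "KKT_set F g \<E> \<I> L \<subseteq> SOL (feasible_set g \<E> \<I>) (peval_vec F)"
proof
  fix x assume x: "x \<in> KKT_set F g \<E> \<I> L"
  let ?X = "feasible_set g \<E> \<I>"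
  have xX: "x \<in> ?X"
    using x by (auto simp: KKT_set_def feasible_set_def)
  have "(y - x) \<bullet> peval_vec F x \<ge> 0" if y: "y \<in> ?X" for y
  proof -
    have "peval (lme L F $ i) x * (peval_vec (pgrad (g $ i)) x \<bullet> (y - x)) \<ge> 0" for i
    proof -
      note deriv = has_derivative_peval[of "g $ i" x]
      consider "i \<in> \<E>" | "i \<in> \<I>" "peval (g $ i) x = 0" | "peval (lme L F $ i) x = 0"
        using cover x by (auto simp: KKT_set_def)
      then show ?thesis
      proof cases
        case 1
        then have "peval (g $ i) z = 0" if "z \<in> ?X" for z
          using that by (simp add: feasible_set_def)
        then have "peval_vec (pgrad (g $ i)) x \<bullet> (y - x) \<ge> 0"
          and "- peval_vec (pgrad (g $ i)) x \<bullet> (y - x) \<ge> 0"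
          using convex_first_order[OF conv xX y deriv]
            convex_first_order[OF conv xX y, of "\<lambda>z. - peval (g $ i) z" "- peval_vec (pgrad (g $ i)) x"]
            has_derivative_minus[OF deriv] xX by auto
        then show ?thesis
          by simp
      next
        case 2
        then have "peval_vec (pgrad (g $ i)) x \<bullet> (y - x) \<ge> 0"
          using convex_first_order[OF conv xX y deriv] by (simp add: feasible_set_def)
        moreover have "peval (lme L F $ i) x \<ge> 0"
          using 2 x by (simp add: KKT_set_def)
        ultimately show ?thesis
          by simp
      qed simp
    qed
    then have "(\<Sum>i\<in>UNIV. peval (lme L F $ i) x * (peval_vec (pgrad (g $ i)) x \<bullet> (y - x))) \<ge> 0"
      by (intro sum_nonneg) auto
    moreover have "peval_vec F x = (\<Sum>i\<in>UNIV. peval (lme L F $ i) x *\<^sub>R peval_vec (pgrad (g $ i)) x)"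
      using x by (simp add: KKT_set_def)
    ultimately show ?thesis
      by (simp add: inner_sum_right inner_commute)
  qed
  with xX show "x \<in> SOL ?X (peval_vec F)"
    by (simp add: SOL_def)
qed

section \<open>Existence of minimizers\<close>

lemma closed_KKT_set: "closed (KKT_set F g \<E> \<I> L)"
proof -
  have "continuous_on UNIV (peval_vec p :: real ^ 'n \<Rightarrow> real ^ 'd)" for p :: "'n::finite rpoly ^ 'd"
    using tendsto_peval_vec[OF tendsto_ident_at, of p] by (simp add: continuous_on_def)
  then show ?thesis
    unfolding KKT_set_def Ball_def imp_conv_disj
    by (intro closed_Collect_conj closed_Collect_all closed_Collect_disj closed_Collect_const
        closed_Collect_eq closed_Collect_le continuous_intros continuous_on_peval) auto
qed

text \<open>The constant is the minimum of the quadratic form on the unit sphere.\<close>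

lemma posdef_coercive:
  fixes A :: "real ^ 'k ^ 'k"
  assumes "posdef A"
  obtains c where "c > 0" "\<And>v. c * (norm v)\<^sup>2 \<le> v \<bullet> (A *v v)"
proof -
  have "\<exists>u\<in>sphere 0 1. \<forall>v\<in>sphere 0 1. u \<bullet> (A *v u) \<le> v \<bullet> (A *v v)"
    by (intro continuous_attains_inf continuous_intros) (auto simp: matrix_vector_mult_linear_continuous_on)
  then obtain u where u: "norm u = 1" "\<And>v. norm v = 1 \<Longrightarrow> u \<bullet> (A *v u) \<le> v \<bullet> (A *v v)"
    by auto
  show thesis
  proof (rule that[of "u \<bullet> (A *v u)"])
    show "u \<bullet> (A *v u) > 0"
      using assms u(1) by (cases "u = 0") (auto simp: posdef_def)
    show "u \<bullet> (A *v u) * (norm v)\<^sup>2 \<le> v \<bullet> (A *v v)" for v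
    proof (cases "v = 0")
      case False
      define w where "w = v /\<^sub>R norm v"
      have "norm w = 1" and v: "v = norm v *\<^sub>R w"
        using False by (simp_all add: w_def)
      have "v \<bullet> (A *v v) = (norm v)\<^sup>2 * (w \<bullet> (A *v w))"
        by (subst (1 2) v) (simp add: matrix_vector_mult_scaleR power2_eq_square)
      then show ?thesis
        using u(2)[OF \<open>norm w = 1\<close>] by (simp add: mult.commute mult_right_mono)
    qed simp
  qed
qed

lemma norm_homog: "(norm (homog x))\<^sup>2 = 1 + (norm x)\<^sup>2"
proof -
  have "(\<Sum>i\<in>UNIV. homog x $ i * homog x $ i) = 1 + (\<Sum>k\<in>UNIV. x $ k * x $ k)"
    by (simp add: homog_def UNIV_option_conv sum.reindex)
  then show ?thesis
    by (simp add: power2_norm_eq_inner inner_vec_def)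
qed

lemma posdef_attains_min_on_closed:
  fixes K :: "(real ^ 'n::finite) set"
  assumes "posdef \<Theta>" "closed K" "K \<noteq> {}"
  shows "\<exists>x. is_arg_min (\<lambda>x. homog x \<bullet> (\<Theta> *v homog x)) (\<lambda>x. x \<in> K) x"
proof -
  let ?q = "\<lambda>x. homog x \<bullet> (\<Theta> *v homog x)"
  obtain c where c: "c > 0" "\<And>v. c * (norm v)\<^sup>2 \<le> v \<bullet> (\<Theta> *v v)"
    using posdef_coercive[OF assms(1)] by blast
  obtain x0 where x0: "x0 \<in> K"
    using assms(3) by blast
  have cont: "continuous_on S (homog :: real ^ 'n \<Rightarrow> _)" for S
    unfolding homog_def
  proof (rule continuous_on_vec_lambda)
    show "continuous_on S (\<lambda>x :: real ^ 'n. case i of None \<Rightarrow> 1 | Some k \<Rightarrow> x $ k)" for i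
      by (cases i) (auto intro!: continuous_intros)
  qed
  \<comment> \<open>The sublevel set of \<open>x0\<close> lies in the ball of radius \<open>R\<close>, because \<open>c * (norm x)\<^sup>2 \<le> ?q x\<close>.\<close>
  define R where "R = sqrt (?q x0 / c)"
  have R: "norm x \<le> R" if "?q x \<le> ?q x0" for x
  proof -
    have "c * (norm x)\<^sup>2 \<le> ?q x0"
      using c(2)[of "homog x"] c(1) that by (simp add: norm_homog distrib_left)
    then show ?thesis
      unfolding R_def using c(1) by (intro real_le_rsqrt) (simp add: field_simps)
  qed
  have "\<exists>x\<in>K \<inter> cball 0 R. \<forall>y\<in>K \<inter> cball 0 R. ?q x \<le> ?q y"
  proof (rule continuous_attains_inf)
    show "compact (K \<inter> cball 0 R)"
      using assms(2) by (simp add: closed_Int_compact)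
    show "K \<inter> cball 0 R \<noteq> {}"
      using x0 R[of x0] by auto
    show "continuous_on (K \<inter> cball 0 R) ?q"
      by (intro continuous_on_inner cont matrix_vector_mult_linear_continuous_on[THEN continuous_on_compose2, of _ homog]) auto
  qed
  then obtain x where x: "x \<in> K" "\<And>y. y \<in> K \<Longrightarrow> norm y \<le> R \<Longrightarrow> ?q x \<le> ?q y"
    by auto
  have "?q x \<le> ?q y" if "y \<in> K" for y
  proof (cases "?q y \<le> ?q x0")
    case True
    then show ?thesis using x(2) R that by blast
  next
    case False
    then show ?thesis using x(2)[OF x0] R[of x0] by linarith
  qed
  with x(1) show ?thesis
    by (auto simp: is_arg_min_linorder)
qed

theorem proposition3p1:
  fixes F :: "'n::finite rpoly ^ 'n"
    and g :: "'n rpoly ^ 'm::finite"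
    and \<E> \<I> :: "'m set"
    and L :: "'n rpoly ^ ('n + 'm) ^ 'm"
    and X :: "(real ^ 'n) set"
  assumes "\<E> \<inter> \<I> = {}" and "\<E> \<union> \<I> = UNIV"
    and "X = feasible_set g \<E> \<I>"
    and "X \<noteq> {}" and "closed X" and "convex X"
    and "nonsingular_tuple g"
    and "L ** G_mat g = mat 1"
  shows "AE \<Theta> in (sym_lborel :: (real ^ 'n option ^ 'n option) measure). posdef \<Theta> \<longrightarrow>
    (let K = KKT_set F g \<E> \<I> L;
         minimizers = {x. is_arg_min (\<lambda>x. homog x \<bullet> (\<Theta> *v homog x)) (\<lambda>x. x \<in> K) x}
     in (K = {} \<longrightarrow> SOL X (peval_vec F) = {}) \<and>
        (K \<noteq> {} \<longrightarrow> minimizers \<noteq> {} \<and> (\<forall>x\<in>minimizers. x \<in> SOL X (peval_vec F))))"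
proof (rule AE_I2, rule impI)
  fix \<Theta> :: "real ^ 'n option ^ 'n option"
  assume pd: "posdef \<Theta>"
  have K: "KKT_set F g \<E> \<I> L = SOL X (peval_vec F)"
    using SOL_subset_KKT_set[OF assms(1,2,8), of F] KKT_set_subset_SOL[of \<E> \<I> g F L] assms(2,3,6)
    by blast
  show "let K = KKT_set F g \<E> \<I> L;
         minimizers = {x. is_arg_min (\<lambda>x. homog x \<bullet> (\<Theta> *v homog x)) (\<lambda>x. x \<in> K) x}
     in (K = {} \<longrightarrow> SOL X (peval_vec F) = {}) \<and>
        (K \<noteq> {} \<longrightarrow> minimizers \<noteq> {} \<and> (\<forall>x\<in>minimizers. x \<in> SOL X (peval_vec F)))"
    using posdef_attains_min_on_closed[OF pd closed_KKT_set[of F g \<E> \<I> L]] K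
    by (auto simp: Let_def is_arg_min_def)
qed

end
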